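(* Let $T>0$, $I=[0,T]$. Let $\{\alpha_n\}_{n\ge 1}$, $\{\beta_n\}_{n\ge 1}$, $\alpha$, $\beta$ be continuous functions $I\to(0,1]$ (time-varying memory exponents). Assume: (1) $\lim_{n\to\infty}\sup_{t\in I}|\alpha_n(t)-\alpha(t)|=0$ and $\lim_{n\to\infty}\sup_{t\in I}|\beta_n(t)-\beta(t)|=0$; (2) there exist constants $0<m\le M\le 1$ such that for all $n\ge 1$ and all $t\in I$, $m\le \alpha_n(t),\beta_n(t),\alpha(t),\beta(t)\le M$. Then for any fixed $x\in\mathcal{C}^1(I)$ and every $\varepsilon\in(0,T)$, $$\sup_{t\in[\varepsilon,T]}\bigl|\mathscr{V}_{\alpha_n,\beta_n}[x](t)-\mathscr{V}_{\alpha,\beta}[x](t)\bigr|\to 0\qquad(n\to\infty).$$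
   Context: $\mathcal{C}^1(I)$ is the space of continuously differentiable real-valued functions on $I=[0,T]$ (one-sided derivatives at the endpoints). A time-varying memory exponent is a continuous function $\varrho:I\to\mathbb{R}$ with $\varrho(t)\in(0,1]$ for all $t\in I$. Its memory kernel is $K_\varrho(t,\tau)=\frac{(t-\tau)^{\varrho(t)-1}}{\Gamma(\varrho(t))}$ for $0\le\tau<t\le T$, and $K_\varrho(t,\tau)=0$ for $\tau\ge t$, where $\Gamma$ is the Gamma function. For memory exponents $\alpha,\beta$ and $x\in\mathcal{C}^1(I)$, the memory-weighted velocity operator is the function $\mathscr{V}_{\alpha,\beta}[x]:I\to\mathbb{R}$ given by $$\mathscr{V}_{\alpha,\beta}[x](t)=\frac{\int_0^t K_\alpha(t,\tau)\,[x(t)-x(\tau)]\,d\tau}{\int_0^t K_\beta(t,\tau)\,(t-\tau)\,d\tau}\quad (t\in(0,T]),\qquad \mathscr{V}_{\alpha,\beta}[x](0)=\dot{x}(0).$$ *)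

theory Defs
  imports "HOL-Analysis.Analysis"
begin

text \<open>The library's \<open>C1_differentiable_on\<close> takes two-sided derivatives at every point of the set.
  Functions on \<open>[0,T]\<close> are total functions \<open>real \<Rightarrow> real\<close> of which only the values on \<open>[0,T]\<close>
  may matter, so here derivatives are taken within the set (one-sided at the endpoints).\<close>

definition C1_on :: "real set \<Rightarrow> (real \<Rightarrow> real) \<Rightarrow> bool" where
  "C1_on S x \<longleftrightarrow>
     (\<exists>x'. (\<forall>t\<in>S. (x has_real_derivative x' t) (at t within S)) \<and> continuous_on S x')"

definition memory_exponent :: "real \<Rightarrow> (real \<Rightarrow> real) \<Rightarrow> bool" where
  "memory_exponent T \<rho> \<longleftrightarrow> continuous_on {0..T} \<rho> \<and> (\<forall>t\<in>{0..T}. 0 < \<rho> t \<and> \<rho> t \<le> 1)"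

definition memory_kernel :: "(real \<Rightarrow> real) \<Rightarrow> real \<Rightarrow> real \<Rightarrow> real" where
  "memory_kernel \<rho> t \<tau> =
     (if \<tau> < t then (t - \<tau>) powr (\<rho> t - 1) / Gamma (\<rho> t) else 0)"

text \<open>\<open>T\<close> enters only through the one-sided derivative at \<open>0\<close>. For memory exponents and \<open>C\<^sup>1\<close>
  functions both integrands are absolutely integrable on \<open>[0,t]\<close>, so the Henstock--Kurzweil
  integral used here is the Lebesgue integral.\<close>

definition memory_velocity ::
  "real \<Rightarrow> (real \<Rightarrow> real) \<Rightarrow> (real \<Rightarrow> real) \<Rightarrow> (real \<Rightarrow> real) \<Rightarrow> real \<Rightarrow> real" where
  "memory_velocity T \<alpha> \<beta> x t =
     (if t = 0 then vector_derivative x (at 0 within {0..T})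
      else integral {0..t} (\<lambda>\<tau>. memory_kernel \<alpha> t \<tau> * (x t - x \<tau>)) /
           integral {0..t} (\<lambda>\<tau>. memory_kernel \<beta> t \<tau> * (t - \<tau>)))"

end

(* Extended by zero to tau >= t, the integrand of the unnormalised numerator is jointly continuous
   in (t, a, tau), a being the value of the exponent: for a Lipschitz function x the factor
   x t - x tau absorbs the singularity of (t - tau)^(a - 1). Hence the numerator is a continuous
   function of (t, a), and so is the denominator, which is the case x = id. The velocity is thus a
   fixed continuous function of (t, alpha t, beta t) on the compact set
   [epsilon, T] x [m, M] x [m, M], and uniform continuity transfers the uniform convergence of the
   exponents. *)
theory Submission
  imports Defs
begin

text \<open>Truncating the base extends the integrand by zero to \<open>\<tau> \<ge> t\<close>,
  because \<open>0 powr y = 0\<close> for every \<open>y\<close>. The exponent enters as a number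
  \<open>a\<close> and the factor \<open>1 / Gamma a\<close>, constant in \<open>\<tau>\<close>, is
  left out, so that joint continuity in \<open>t\<close>, \<open>a\<close>, \<open>\<tau>\<close>
  can be stated.\<close>

definition memory_integrand :: "(real \<Rightarrow> real) \<Rightarrow> real \<Rightarrow> real \<Rightarrow> real \<Rightarrow> real" where
  "memory_integrand x t a \<tau> = max (t - \<tau>) 0 powr (a - 1) * (x t - x \<tau>)"

lemma C1_on_imp_lipschitz:
  assumes "C1_on {a..b} x"
  obtains L where "L-lipschitz_on {a..b} x"
proof -
  obtain x' where d: "\<And>t. t \<in> {a..b} \<Longrightarrow> (x has_real_derivative x' t) (at t within {a..b})"
    and c: "continuous_on {a..b} x'"
    using assms unfolding C1_on_def by blast
  have "bounded (x' ` {a..b})"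
    using c by (intro compact_imp_bounded compact_continuous_image) auto
  then obtain B where B: "B > 0" "\<And>t. t \<in> {a..b} \<Longrightarrow> norm (x' t) \<le> B"
    by (auto simp: bounded_pos)
  have "B-lipschitz_on {a..b} x"
  proof (rule lipschitz_onI)
    fix s t assume st: "s \<in> {a..b}" "t \<in> {a..b}"
    have "norm (x s - x t) \<le> B * norm (s - t)"
      by (rule field_differentiable_bound[where S = "{a..b}" and f' = x']) (use d B st in auto)
    then show "dist (x s) (x t) \<le> B * dist s t"
      by (simp add: dist_norm)
  qed (use B in simp)
  with that show thesis by blast
qed

text \<open>Translates between convergence of suprema and \<open>uniform_limit\<close>, for which
  composition theorems exist. Nonemptiness of \<open>A\<close> matters: in \<open>ereal\<close> the
  supremum over the empty set is minus infinity.\<close>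

lemma SUP_ereal_dist_tendsto_0_iff:
  fixes f :: "nat \<Rightarrow> 'a \<Rightarrow> real"
  assumes "A \<noteq> {}"
  shows "(\<lambda>n. SUP t\<in>A. ereal \<bar>f n t - g t\<bar>) \<longlonglongrightarrow> 0 \<longleftrightarrow> uniform_limit A f g sequentially"
    (is "?S \<longlonglongrightarrow> 0 \<longleftrightarrow> _")
proof
  assume lim: "?S \<longlonglongrightarrow> 0"
  show "uniform_limit A f g sequentially"
  proof (rule uniform_limitI)
    fix e :: real assume "e > 0"
    then have "eventually (\<lambda>n. ?S n < ereal e) sequentially"
      by (intro order_tendstoD(2)[OF lim]) simp
    then show "\<forall>\<^sub>F n in sequentially. \<forall>t\<in>A. dist (f n t) (g t) < e"
    proof eventually_elim
      case (elim n)
      have "ereal \<bar>f n t - g t\<bar> < ereal e" if "t \<in> A" for t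
        using SUP_upper[OF that, of "\<lambda>t. ereal \<bar>f n t - g t\<bar>"] elim by (rule le_less_trans)
      then show ?case by (simp add: dist_real_def)
    qed
  qed
next
  assume lim: "uniform_limit A f g sequentially"
  have nonneg: "0 \<le> ?S n" for n
    using assms by (auto intro: SUP_upper2)
  show "?S \<longlonglongrightarrow> 0"
  proof (rule order_tendstoI)
    fix y :: ereal assume "y < 0"
    then show "eventually (\<lambda>n. y < ?S n) sequentially"
      using nonneg by (intro always_eventually allI) (rule less_le_trans)
  next
    fix y :: ereal assume "0 < y"
    \<comment> \<open>Pointwise strict bounds give only a weak bound on the supremum, so a real
      \<open>e\<close> strictly below \<open>y\<close> is interposed; it also covers infinite
      \<open>y\<close>.\<close>
    then obtain e where e: "0 < ereal e" "ereal e < y"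
      using ereal_dense2 by blast
    then have "\<forall>\<^sub>F n in sequentially. \<forall>t\<in>A. dist (f n t) (g t) < e"
      using lim by (intro uniform_limitD) auto
    then show "eventually (\<lambda>n. ?S n < y) sequentially"
    proof eventually_elim
      case (elim n)
      then have "?S n \<le> ereal e"
        by (intro SUP_least) (auto simp: dist_real_def less_imp_le)
      with e show ?case by (rule_tac le_less_trans)
    qed
  qed
qed

lemma uniform_limit_Pair:
  assumes "uniform_limit A f f' F" and "uniform_limit A g g' F"
  shows "uniform_limit A (\<lambda>n t. (f n t, g n t)) (\<lambda>t. (f' t, g' t)) F"
proof (rule uniform_limitI)
  fix e :: real assume "e > 0"
  then have "\<forall>\<^sub>F n in F. \<forall>t\<in>A. dist (f n t) (f' t) < e/2"
    and "\<forall>\<^sub>F n in F. \<forall>t\<in>A. dist (g n t) (g' t) < e/2"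
    using uniform_limitD[OF assms(1), of "e/2"] uniform_limitD[OF assms(2), of "e/2"] by simp_all
  then show "\<forall>\<^sub>F n in F. \<forall>t\<in>A. dist (f n t, g n t) (f' t, g' t) < e"
  proof eventually_elim
    case (elim n)
    show ?case
    proof
      fix t assume "t \<in> A"
      then have "dist (f n t) (f' t) + dist (g n t) (g' t) < e"
        using elim by fastforce
      moreover have "dist (f n t, g n t) (f' t, g' t) \<le> dist (f n t) (f' t) + dist (g n t) (g' t)"
        by (simp add: dist_Pair_Pair sqrt_sum_squares_le_sum)
      ultimately show "dist (f n t, g n t) (f' t, g' t) < e" by linarith
    qed
  qed
qed

text \<open>Where \<open>\<tau> < t\<close> this is a product of continuous functions. Where
  \<open>t \<le> \<tau>\<close> the value is 0, and the Lipschitz bound squeezes the integrand under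
  \<open>?h\<close>, which tends to 0 there since \<open>a > 0\<close>.\<close>

lemma continuous_on_memory_integrand:
  assumes L: "L-lipschitz_on S x" and A: "A \<subseteq> {0<..}"
  shows "continuous_on ((S \<times> A) \<times> S) (\<lambda>(p, \<tau>). memory_integrand x (fst p) (snd p) \<tau>)"
    (is "continuous_on ?D ?g")
proof -
  let ?d = "\<lambda>q :: (real \<times> real) \<times> real. max (fst (fst q) - snd q) 0"
  let ?h = "\<lambda>q. L * ?d q powr snd (fst q)"
  have x: "continuous_on S x"
    using L by (rule lipschitz_on_continuous_on)
  have d: "continuous_on ?D ?d"
    by (intro continuous_intros)
  have diff: "continuous_on ?D (\<lambda>q. x (fst (fst q)) - x (snd q))"
    by (intro continuous_intros continuous_on_compose2[OF x]) auto
  \<comment> \<open>Positivity of the exponents in \<open>A\<close> gives continuity of the power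
    even where its base is 0.\<close>
  have h: "continuous_on ?D ?h"
    by (intro continuous_intros continuous_on_powr' d) (use A in auto)
  have bound: "norm (?g q) \<le> ?h q" if "q \<in> ?D" for q
  proof -
    obtain t a \<tau> where q: "q = ((t, a), \<tau>)" by (metis prod.exhaust)
    with that have "t \<in> S" "\<tau> \<in> S" by auto
    then have "\<bar>x t - x \<tau>\<bar> \<le> L * \<bar>t - \<tau>\<bar>"
      using lipschitz_onD[OF L] by (simp add: dist_real_def)
    then have "(t - \<tau>) powr (a - 1) * \<bar>x t - x \<tau>\<bar> \<le> L * (t - \<tau>) powr a" if "\<tau> < t"
    proof -
      have "(t - \<tau>) powr (a - 1) * \<bar>x t - x \<tau>\<bar> \<le> (t - \<tau>) powr (a - 1) * (L * (t - \<tau>))"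
        using \<open>\<bar>x t - x \<tau>\<bar> \<le> L * \<bar>t - \<tau>\<bar>\<close> that by (intro mult_left_mono) auto
      also have "\<dots> = L * (t - \<tau>) powr a"
        using that by (simp add: powr_diff)
      finally show ?thesis .
    qed
    then show ?thesis
      unfolding q memory_integrand_def by (cases "\<tau> < t") (auto simp: abs_mult max_def)
  qed
  have "(?g \<longlongrightarrow> ?g q) (at q within ?D)" if q: "q \<in> ?D" for q
  proof (cases "?d q = 0")
    \<comment> \<open>Here \<open>a - 1\<close> may be negative, so the power alone need not be
      continuous; only the product with the increment of \<open>x\<close> is controlled.\<close>
    case True
    have "(?h \<longlongrightarrow> ?h q) (at q within ?D)"
      using h q by (auto simp: continuous_on_def)
    moreover have "?h q = 0"
      using True by simp
    moreover have "?g q = 0"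
      using True by (simp add: memory_integrand_def case_prod_unfold)
    moreover have "eventually (\<lambda>p. norm (?g p) \<le> ?h p) (at q within ?D)"
      using bound by (auto simp: eventually_at_filter)
    ultimately show ?thesis
      using Lim_null_comparison[of ?g ?h "at q within ?D"] by simp
  next
    case False
    have "((\<lambda>q. ?d q powr (snd (fst q) - 1) * (x (fst (fst q)) - x (snd q))) \<longlongrightarrow>
        ?d q powr (snd (fst q) - 1) * (x (fst (fst q)) - x (snd q))) (at q within ?D)"
    proof (intro tendsto_mult tendsto_powr[OF _ _ False])
      show "(?d \<longlongrightarrow> ?d q) (at q within ?D)"
        and "((\<lambda>q. x (fst (fst q)) - x (snd q)) \<longlongrightarrow> x (fst (fst q)) - x (snd q)) (at q within ?D)"
        using d diff q by (auto simp: continuous_on_def)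
      show "((\<lambda>q. snd (fst q) - 1) \<longlongrightarrow> snd (fst q) - 1) (at q within ?D)"
        by (intro tendsto_diff tendsto_snd tendsto_fst tendsto_ident_at tendsto_const)
    qed
    then show ?thesis
      by (simp add: memory_integrand_def case_prod_unfold)
  qed
  then show ?thesis
    by (auto simp: continuous_on_def)
qed

text \<open>Thanks to the extension by zero, the domain of integration is independent of
  \<open>t\<close>, so the theorem on parameter integrals over a fixed compact interval
  applies.\<close>

lemma continuous_on_integral_memory_integrand:
  assumes "L-lipschitz_on {0..T} x" and "A \<subseteq> {0<..}"
  shows "continuous_on ({0..T} \<times> A)
           (\<lambda>p. integral {0..T} (memory_integrand x (fst p) (snd p)))"
  using integral_continuous_on_param[OF
      continuous_on_memory_integrand[OF assms, unfolded cbox_interval[symmetric]]]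
  by simp

lemma integral_memory_kernel:
  assumes "t \<le> T"
  shows "integral {0..t} (\<lambda>\<tau>. memory_kernel \<rho> t \<tau> * (x t - x \<tau>)) =
         integral {0..T} (memory_integrand x t (\<rho> t)) / Gamma (\<rho> t)"
proof -
  have "integral {0..t} (\<lambda>\<tau>. memory_kernel \<rho> t \<tau> * (x t - x \<tau>)) =
        integral {0..t} (\<lambda>\<tau>. memory_integrand x t (\<rho> t) \<tau> / Gamma (\<rho> t))"
    by (intro integral_cong) (auto simp: memory_kernel_def memory_integrand_def)
  also have "\<dots> = integral {0..t} (memory_integrand x t (\<rho> t)) / Gamma (\<rho> t)"
    by simp
  \<comment> \<open>The integrand vanishes for \<open>\<tau> > t\<close>, so enlarging the interval
    to \<open>{0..T}\<close> adds nothing.\<close>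
  also have "integral {0..t} (memory_integrand x t (\<rho> t)) =
      integral {0..T} (\<lambda>\<tau>. if \<tau> \<in> {0..t} then memory_integrand x t (\<rho> t) \<tau> else 0)"
    unfolding Henstock_Kurzweil_Integration.integral_restrict_Int using assms
    by (simp add: Int_absorb2)
  also have "\<dots> = integral {0..T} (memory_integrand x t (\<rho> t))"
    by (intro integral_cong) (auto simp: memory_integrand_def)
  finally show ?thesis .
qed

lemma memory_velocity_eq:
  assumes "0 < t" and "t \<le> T"
  shows "memory_velocity T \<alpha> \<beta> x t =
    (integral {0..T} (memory_integrand x t (\<alpha> t)) / Gamma (\<alpha> t)) /
    (integral {0..T} (memory_integrand (\<lambda>s. s) t (\<beta> t)) / Gamma (\<beta> t))"
  using assms integral_memory_kernel[of t T \<alpha> x] integral_memory_kernel[of t T \<beta> "\<lambda>s. s"]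
  by (simp add: memory_velocity_def)

lemma lipschitz_on_ident: "1-lipschitz_on S (\<lambda>s :: real. s)"
  by (rule lipschitz_onI) auto

text \<open>A continuous nonnegative function has zero integral only if it vanishes identically, but
  at \<open>\<tau> = 0\<close> this one equals \<open>t powr a > 0\<close>.\<close>

lemma integral_memory_integrand_ident_nonzero:
  assumes "0 < t" "t \<le> T" "0 < a"
  shows "integral {0..T} (memory_integrand (\<lambda>s. s) t a) \<noteq> 0"
proof -
  have "continuous_on {0..T} (\<lambda>\<tau>. memory_integrand (\<lambda>s. s) t a \<tau>)"
    using continuous_on_compose2[OF continuous_on_memory_integrand[OF lipschitz_on_ident,
      of "{0<..}" "{0..T}"], of "{0..T}" "\<lambda>\<tau>. ((t, a), \<tau>)"] assms
    by (force intro: continuous_intros)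
  moreover have "memory_integrand (\<lambda>s. s) t a \<tau> \<ge> 0" for \<tau>
    by (auto simp: memory_integrand_def max_def)
  moreover have "memory_integrand (\<lambda>s. s) t a 0 \<noteq> 0"
    using assms by (simp add: memory_integrand_def)
  ultimately show ?thesis
    using integral_eq_0_iff[of 0 T "memory_integrand (\<lambda>s. s) t a"] assms by force
qed

theorem theorem2p1:
  fixes T m M \<epsilon> :: real
    and \<alpha>n \<beta>n :: "nat \<Rightarrow> real \<Rightarrow> real"
    and \<alpha> \<beta> x :: "real \<Rightarrow> real"
  assumes "T > 0"
    and "\<And>n. n \<ge> 1 \<Longrightarrow> memory_exponent T (\<alpha>n n)"
    and "\<And>n. n \<ge> 1 \<Longrightarrow> memory_exponent T (\<beta>n n)"
    and "memory_exponent T \<alpha>"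
    and "memory_exponent T \<beta>"
    and "(\<lambda>n. SUP t\<in>{0..T}. ereal \<bar>\<alpha>n n t - \<alpha> t\<bar>) \<longlonglongrightarrow> 0"
    and "(\<lambda>n. SUP t\<in>{0..T}. ereal \<bar>\<beta>n n t - \<beta> t\<bar>) \<longlonglongrightarrow> 0"
    and "0 < m" and "m \<le> M" and "M \<le> 1"
    and "\<And>n t. n \<ge> 1 \<Longrightarrow> t \<in> {0..T} \<Longrightarrow>
           \<alpha>n n t \<in> {m..M} \<and> \<beta>n n t \<in> {m..M} \<and> \<alpha> t \<in> {m..M} \<and> \<beta> t \<in> {m..M}"
    and "C1_on {0..T} x"
    and "0 < \<epsilon>" and "\<epsilon> < T"
  shows "(\<lambda>n. SUP t\<in>{\<epsilon>..T}.
            ereal \<bar>memory_velocity T (\<alpha>n n) (\<beta>n n) x t - memory_velocity T \<alpha> \<beta> x t\<bar>)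
         \<longlonglongrightarrow> 0"
proof -
  define W where "W = (\<lambda>(t, a, b).
    (integral {0..T} (memory_integrand x t a) / Gamma a) /
    (integral {0..T} (memory_integrand (\<lambda>s. s) t b) / Gamma b))"
  \<comment> \<open>The bound \<open>\<epsilon>\<close> keeps \<open>t\<close> away from 0, where
    the integral in the denominator of \<open>W\<close> vanishes; the bound \<open>m\<close> keeps
    the exponents away from the pole of \<open>Gamma\<close> at 0.\<close>
  let ?K = "{\<epsilon>..T} \<times> {m..M} \<times> {m..M}"
  obtain L where L: "L-lipschitz_on {0..T} x"
    using assms(12) by (rule C1_on_imp_lipschitz)
  have pos: "{m..M} \<subseteq> {0<..}"
    using assms(8) by auto
  have \<Gamma>: "continuous_on {m..M} (Gamma :: real \<Rightarrow> real)"
    by (intro continuous_on_Gamma) (use assms(8) in \<open>auto elim!: nonpos_Ints_cases\<close>)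
  have \<Gamma>_nz: "Gamma a \<noteq> (0 :: real)" if "a \<in> {m..M}" for a
    proof -
    have "0 < a"
      using that assms(8) by auto
    then show ?thesis
      using Gamma_real_pos[of a] by linarith
  qed
  have num: "continuous_on ?K (\<lambda>q. integral {0..T} (memory_integrand x (fst q) (fst (snd q))))"
    using continuous_on_compose2[OF continuous_on_integral_memory_integrand[OF L pos],
      of ?K "\<lambda>q. (fst q, fst (snd q))"] assms(13)
    by (force intro: continuous_intros)
  have den: "continuous_on ?K
      (\<lambda>q. integral {0..T} (memory_integrand (\<lambda>s. s) (fst q) (snd (snd q))))"
    using continuous_on_compose2[OF continuous_on_integral_memory_integrand[OF lipschitz_on_ident pos],
      of ?K "\<lambda>q. (fst q, snd (snd q))"] assms(13)
    by (force intro: continuous_intros)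
  have "continuous_on ?K W"
    unfolding W_def case_prod_unfold
  proof (intro continuous_on_divide num den ballI)
    show "continuous_on ?K (\<lambda>q. Gamma (fst (snd q)))" "continuous_on ?K (\<lambda>q. Gamma (snd (snd q)))"
      by (auto intro!: continuous_on_compose2[OF \<Gamma>] continuous_intros)
    fix q assume "q \<in> ?K"
    then have "0 < fst q" "fst q \<le> T" "fst (snd q) \<in> {m..M}" "snd (snd q) \<in> {m..M}"
      using assms(13) by auto
    then show "Gamma (fst (snd q)) \<noteq> 0" "Gamma (snd (snd q)) \<noteq> 0"
      and "integral {0..T} (memory_integrand (\<lambda>s. s) (fst q) (snd (snd q))) / Gamma (snd (snd q)) \<noteq> 0"
      using \<Gamma>_nz integral_memory_integrand_ident_nonzero[of "fst q" T "snd (snd q)"] assms(8)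
      by auto
  qed
  then have unif: "uniformly_continuous_on ?K W"
    by (intro compact_uniformly_continuous compact_Times) auto
  have lim: "uniform_limit {\<epsilon>..T} (\<lambda>n t. (t, \<alpha>n n t, \<beta>n n t)) (\<lambda>t. (t, \<alpha> t, \<beta> t)) sequentially"
  proof (intro uniform_limit_Pair uniform_limit_const)
    show "uniform_limit {\<epsilon>..T} \<alpha>n \<alpha> sequentially"
      by (rule uniform_limit_on_subset[where J = "{0..T}"])
        (use assms(1,6,13) SUP_ereal_dist_tendsto_0_iff[of "{0..T}" \<alpha>n \<alpha>] in auto)
    show "uniform_limit {\<epsilon>..T} \<beta>n \<beta> sequentially"
      by (rule uniform_limit_on_subset[where J = "{0..T}"])
        (use assms(1,7,13) SUP_ereal_dist_tendsto_0_iff[of "{0..T}" \<beta>n \<beta>] in auto)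
  qed
  \<comment> \<open>The bounds on the exponents are available only from \<open>n = 1\<close> on,
    hence the eventual form.\<close>
  have in_K: "\<forall>\<^sub>F n in sequentially. \<forall>t\<in>{\<epsilon>..T}. (t, \<alpha>n n t, \<beta>n n t) \<in> ?K"
    using eventually_ge_at_top[of 1] by eventually_elim (use assms(11,13) in force)
  have "uniform_limit {\<epsilon>..T} (\<lambda>n t. W (t, \<alpha>n n t, \<beta>n n t)) (\<lambda>t. W (t, \<alpha> t, \<beta> t)) sequentially"
    \<comment> \<open>Closedness of \<open>?K\<close> ensures that the limit points
      \<open>(t, \<alpha> t, \<beta> t)\<close> lie in it as well.\<close>
    by (rule uniform_limit_compose_uniformly_continuous_on[OF lim unif in_K])
      (intro closed_Times closed_atLeastAtMost)
  \<comment> \<open>Since \<open>t \<ge> \<epsilon> > 0\<close>, the separately defined value at 0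
    never occurs.\<close>
  moreover have "memory_velocity T a b x t = W (t, a t, b t)" if "t \<in> {\<epsilon>..T}" for a b t
    using that assms(13) by (simp add: memory_velocity_eq W_def)
  ultimately have "uniform_limit {\<epsilon>..T} (\<lambda>n. memory_velocity T (\<alpha>n n) (\<beta>n n) x)
      (memory_velocity T \<alpha> \<beta> x) sequentially"
    by (subst uniform_limit_cong') auto
  then show ?thesis
    using assms(14) by (subst SUP_ereal_dist_tendsto_0_iff) auto
qed

end
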